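(* Let $1\le r\le N$ and let $\mathcal{V}_r(N)=\{X\in\mathbb{R}^{N\times r}:X^\top X=I_r\}$ be the Stiefel manifold. Given a density $p>0$ and a kernel $\kappa>0$ of class $C^{(1,1)}$ on $\mathcal{V}_r(N)$, the function $\kappa_p$ on $\mathcal{V}_r(N)$ is given by $$\kappa_p(X,Y)=\langle\mathscr{A}(\nabla^{\mathbb{R}}_X\log(p\kappa)X^\top),\mathscr{A}(\nabla^{\mathbb{R}}_Y\log(p\kappa)Y^\top)\rangle_F\,\kappa(X,Y)+\sum_{i<j}K^{ij}_YK^{ij}_X\log\kappa\cdot\kappa(X,Y).$$ Furthermore, if $\kappa(X,Y)=e^{-\psi(\|X-Y\|_F^2)}$ is a radial kernel for some $\psi\in C^2[0,+\infty)$, then $$\begin{aligned}\kappa_p(X,Y)&=\langle\mathscr{A}(\nabla^{\mathbb{R}}_X\log(p\kappa)X^\top),\mathscr{A}(\nabla^{\mathbb{R}}_Y\log(p\kappa)Y^\top)\rangle_F\,\kappa(X,Y)\\&\quad+(N-1)\psi'(\|X-Y\|_F^2)\langle X,Y\rangle_F\,\kappa(X,Y)\\&\quad+4\psi''(\|X-Y\|_F^2)\,\|\mathscr{A}(XY^\top)\|_F^2\,\kappa(X,Y).\end{aligned}$$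
   Context: $\langle A,B\rangle_F=\mathrm{tr}(A^\top B)$ is the Frobenius inner product, $\|\cdot\|_F$ its norm, and $\mathscr{A}(A)=(A-A^\top)/2$ for square $A$. $E_{ij}$ is the $N\times N$ matrix with a $1$ in entry $(i,j)$ and zeros elsewhere, and $\mathcal{E}_{ij}=\frac{\sqrt2}{2}(E_{ij}-E_{ji})$ for $1\le i<j\le N$. The orthogonal group $O(N)$ acts on $\mathcal{V}_r(N)$ by $O.X=OX$, and the killing field corresponding to $\mathcal{E}_{ij}$ is $K^{ij}_X=\mathcal{E}_{ij}X\in T_X\mathcal{V}_r(N)$. A kernel is real-valued, symmetric, positive semi-definite; $C^{(1,1)}$ means once continuously differentiable in each argument with continuous mixed derivative of order $(1,1)$. For a bivariate function, $K^{ij}_X$, $K^{ij}_Y$ denote $K^{ij}$ acting on the first argument $X$ and second argument $Y$. The function $\kappa_p$ is defined by $$\kappa_p(X,Y)=\kappa(X,Y)\sum_{i<j}\left[K^{ij}_X\log(p(X)\kappa(X,Y))\cdot K^{ij}_Y\log(p(Y)\kappa(X,Y))+K^{ij}_YK^{ij}_X\log\kappa(X,Y)\right].$$ The density $p$ is locally Lipschitz; derivatives of $\log p$ are set to $0$ at points of non-differentiability. For a function $f$ on a submanifold $M\subset\mathbb{R}^{N\times r}$ differentiable at $X$, a Euclidean gradient $\nabla^{\mathbb{R}}_Xf$ is any matrix in $\mathbb{R}^{N\times r}$ with $D_Xf=\langle\nabla^{\mathbb{R}}_Xf,D_X\rangle_F$ for all $D_X\in T_XM\subset\mathbb{R}^{N\times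 r}$ (not unique; the result holds for any choice). $\nabla^{\mathbb{R}}_X\log(p\kappa)$ is the gradient of $X\mapsto\log(p(X)\kappa(X,Y))$ with $Y$ fixed, and similarly $\nabla^{\mathbb{R}}_Y\log(p\kappa)$ is that of $Y\mapsto\log(p(Y)\kappa(X,Y))$ with $X$ fixed. *)

theory Defs
  imports "HOL-Analysis.Analysis"
begin

section \<open>Matrices\<close>

text \<open>
  An \<open>N \<times> r\<close> matrix has type \<^typ>\<open>real ^ 'r ^ 'n\<close> with \<open>N = CARD('n)\<close> and \<open>r = CARD('r)\<close>.
  The library's inner product and norm on this type are the Frobenius ones.
\<close>

lemma frobenius_inner_eq: "trace (transpose A ** B) = A \<bullet> B"
  for A B :: "real ^ 'r ^ 'n"
proof -
  have "trace (transpose A ** B) = (\<Sum>j\<in>UNIV. \<Sum>i\<in>UNIV. A $ i $ j * B $ i $ j)"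
    by (simp add: trace_def matrix_matrix_mult_def transpose_def)
  also have "\<dots> = (\<Sum>i\<in>UNIV. \<Sum>j\<in>UNIV. A $ i $ j * B $ i $ j)"
    by (rule sum.swap)
  finally show ?thesis
    by (simp add: inner_vec_def)
qed

definition skew_part :: "real ^ 'n ^ 'n \<Rightarrow> real ^ 'n ^ 'n" where
  "skew_part A = (1 / 2) *\<^sub>R (A - transpose A)"

definition elementary_matrix :: "'n \<Rightarrow> 'n \<Rightarrow> real ^ 'n ^ 'n" where
  "elementary_matrix i j = (\<chi> k l. if k = i \<and> l = j then 1 else 0)"

definition skew_basis :: "'n \<Rightarrow> 'n \<Rightarrow> real ^ 'n ^ 'n" where
  "skew_basis i j = (sqrt 2 / 2) *\<^sub>R (elementary_matrix i j - elementary_matrix j i)"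


section \<open>Differentiation on a submanifold of a Euclidean space\<close>

text \<open>
  A function on a submanifold \<open>M\<close> is a function on the ambient space of which only the values on
  \<open>M\<close> are used. It is differentiable at \<open>X \<in> M\<close> iff it is differentiable at \<open>X\<close> within \<open>M\<close>; such a
  derivative is a linear map on the ambient space that is determined only on tangent vectors,
  and it is only ever applied to those below.
\<close>

text \<open>Velocities of curves in \<open>M\<close>. On a submanifold, requiring differentiability of the curve
  at \<open>0\<close> only yields the same space as requiring smoothness.\<close>

definition tangent_space :: "'a::real_normed_vector set \<Rightarrow> 'a \<Rightarrow> 'a set" where
  "tangent_space M X =
    {v. \<exists>\<gamma>. \<gamma> 0 = X \<and> (\<forall>t. \<gamma> t \<in> M) \<and> (\<gamma> has_vector_derivative v) (at (0::real))}"

definition euclidean_gradient ::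
    "'a::euclidean_space set \<Rightarrow> ('a \<Rightarrow> real) \<Rightarrow> 'a \<Rightarrow> 'a \<Rightarrow> bool" where
  "euclidean_gradient M f X G \<longleftrightarrow>
    f differentiable (at X within M) \<and>
    (\<forall>D \<in> tangent_space M X. frechet_derivative f (at X within M) D = G \<bullet> D)"

definition locally_lipschitz_on :: "'a::metric_space set \<Rightarrow> ('a \<Rightarrow> real) \<Rightarrow> bool" where
  "locally_lipschitz_on M f \<longleftrightarrow> (\<forall>X\<in>M. \<exists>u>0. \<exists>L. L-lipschitz_on (cball X u \<inter> M) f)"

definition kernel_on :: "'a set \<Rightarrow> ('a \<Rightarrow> 'a \<Rightarrow> real) \<Rightarrow> bool" where
  "kernel_on M \<kappa> \<longleftrightarrow>
    (\<forall>X\<in>M. \<forall>Y\<in>M. \<kappa> X Y = \<kappa> Y X) \<and>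
    (\<forall>S c. finite S \<and> S \<subseteq> M \<longrightarrow> (\<Sum>X\<in>S. \<Sum>Y\<in>S. c X * c Y * \<kappa> X Y) \<ge> 0)"

text \<open>
  Asking for continuous families of derivatives on the whole ambient space is no restriction:
  derivatives along \<open>M\<close> can be extended by precomposing with the orthogonal projections
  onto the tangent spaces.
\<close>

definition C11_on :: "'a::euclidean_space set \<Rightarrow> ('a \<Rightarrow> 'a \<Rightarrow> real) \<Rightarrow> bool" where
  "C11_on M \<kappa> \<longleftrightarrow>
    (\<exists>(D1 :: 'a \<Rightarrow> 'a \<Rightarrow> 'a \<Rightarrow>\<^sub>L real) (D2 :: 'a \<Rightarrow> 'a \<Rightarrow> 'a \<Rightarrow>\<^sub>L real)
      (D12 :: 'a \<Rightarrow> 'a \<Rightarrow> 'a \<Rightarrow>\<^sub>L 'a \<Rightarrow>\<^sub>L real).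
      (\<forall>X\<in>M. \<forall>Y\<in>M.
        ((\<lambda>Z. \<kappa> Z Y) has_derivative blinfun_apply (D1 X Y)) (at X within M) \<and>
        ((\<lambda>Z. \<kappa> X Z) has_derivative blinfun_apply (D2 X Y)) (at Y within M) \<and>
        ((\<lambda>Z. D1 X Z) has_derivative blinfun_apply (D12 X Y)) (at Y within M)) \<and>
      continuous_on (M \<times> M) (\<lambda>(X, Y). D1 X Y) \<and>
      continuous_on (M \<times> M) (\<lambda>(X, Y). D2 X Y) \<and>
      continuous_on (M \<times> M) (\<lambda>(X, Y). D12 X Y))"

text \<open>Twice continuously differentiable on \<open>[0, \<infinity>)\<close> (one-sided at \<open>0\<close>) with first and second
  derivatives \<open>\<psi>'\<close> and \<open>\<psi>''\<close>.\<close>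

definition C2_nonneg :: "(real \<Rightarrow> real) \<Rightarrow> (real \<Rightarrow> real) \<Rightarrow> (real \<Rightarrow> real) \<Rightarrow> bool" where
  "C2_nonneg \<psi> \<psi>' \<psi>'' \<longleftrightarrow>
    (\<forall>t\<ge>0. (\<psi> has_real_derivative \<psi>' t) (at t within {0..}) \<and>
           (\<psi>' has_real_derivative \<psi>'' t) (at t within {0..})) \<and>
    continuous_on {0..} \<psi>''"


section \<open>The Stiefel manifold\<close>

definition stiefel :: "(real ^ 'r ^ 'n) set" where
  "stiefel = {X. transpose X ** X = mat 1}"

text \<open>
  The orthogonal group acts transitively on the Stiefel manifold, so the measures below are
  exactly the positive multiples of the Riemannian volume measure.
\<close>

definition invariant_measure :: "(real ^ 'r ^ 'n) measure \<Rightarrow> bool" where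
  "invariant_measure \<mu> \<longleftrightarrow>
    sets \<mu> = sets (restrict_space borel stiefel) \<and>
    0 < emeasure \<mu> (space \<mu>) \<and> emeasure \<mu> (space \<mu>) < \<infinity> \<and>
    (\<forall>Q :: real ^ 'n ^ 'n. orthogonal_matrix Q \<longrightarrow> distr \<mu> \<mu> (\<lambda>X. Q ** X) = \<mu>)"

definition positive_density :: "(real ^ 'r ^ 'n) measure \<Rightarrow> (real ^ 'r ^ 'n \<Rightarrow> real) \<Rightarrow> bool" where
  "positive_density \<mu> p \<longleftrightarrow>
    (\<forall>X\<in>stiefel. p X > 0) \<and> p \<in> borel_measurable \<mu> \<and> (\<integral>\<^sup>+X. ennreal (p X) \<partial>\<mu>) = 1"

definition killing_field :: "'n \<Rightarrow> 'n \<Rightarrow> real ^ 'r ^ 'n \<Rightarrow> real ^ 'r ^ 'n" where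
  "killing_field i j X = skew_basis i j ** X"

text \<open>The killing field as a derivation, applied to \<open>f\<close> and evaluated at \<open>X\<close>.\<close>

definition killing_deriv :: "'n \<Rightarrow> 'n \<Rightarrow> (real ^ 'r ^ 'n \<Rightarrow> real) \<Rightarrow> real ^ 'r ^ 'n \<Rightarrow> real" where
  "killing_deriv i j f X = frechet_derivative f (at X within stiefel) (killing_field i j X)"

text \<open>
  Convention: derivatives of \<open>log p\<close> are \<open>0\<close> where \<open>log p\<close> is not differentiable. So, for the
  purpose of differentiating at \<open>X\<close>, the density is replaced by the constant \<open>p X\<close> if \<open>log p\<close> is
  not differentiable at \<open>X\<close>; this leaves the contribution of the kernel to the derivatives
  of \<open>log (p \<kappa>)\<close> intact.
\<close>

definition density_at :: "(real ^ 'r ^ 'n \<Rightarrow> real) \<Rightarrow> real ^ 'r ^ 'n \<Rightarrow> real ^ 'r ^ 'n \<Rightarrow> real" where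
  "density_at p X =
    (if (\<lambda>Z. ln (p Z)) differentiable (at X within stiefel) then p else (\<lambda>_. p X))"

text \<open>The functions \<open>log (p(\<cdot>) \<kappa>(\<cdot>, Y))\<close> and \<open>log (p(\<cdot>) \<kappa>(X, \<cdot>))\<close>, to be differentiated at \<open>X\<close>
  and at \<open>Y\<close>, respectively.\<close>

definition log_pk_fst ::
    "(real ^ 'r ^ 'n \<Rightarrow> real) \<Rightarrow> (real ^ 'r ^ 'n \<Rightarrow> real ^ 'r ^ 'n \<Rightarrow> real) \<Rightarrow>
     real ^ 'r ^ 'n \<Rightarrow> real ^ 'r ^ 'n \<Rightarrow> real ^ 'r ^ 'n \<Rightarrow> real" where
  "log_pk_fst p \<kappa> X Y = (\<lambda>Z. ln (density_at p X Z * \<kappa> Z Y))"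

definition log_pk_snd ::
    "(real ^ 'r ^ 'n \<Rightarrow> real) \<Rightarrow> (real ^ 'r ^ 'n \<Rightarrow> real ^ 'r ^ 'n \<Rightarrow> real) \<Rightarrow>
     real ^ 'r ^ 'n \<Rightarrow> real ^ 'r ^ 'n \<Rightarrow> real ^ 'r ^ 'n \<Rightarrow> real" where
  "log_pk_snd p \<kappa> X Y = (\<lambda>Z. ln (density_at p Y Z * \<kappa> X Z))"

text \<open>\<open>K\<^sub>Y K\<^sub>X log \<kappa>\<close> at \<open>(X, Y)\<close>: first differentiate in the first argument, then in the second.\<close>

definition killing_mixed_log ::
    "'n \<Rightarrow> 'n \<Rightarrow> (real ^ 'r ^ 'n \<Rightarrow> real ^ 'r ^ 'n \<Rightarrow> real) \<Rightarrow>
     real ^ 'r ^ 'n \<Rightarrow> real ^ 'r ^ 'n \<Rightarrow> real" where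
  "killing_mixed_log i j \<kappa> X Y =
    killing_deriv i j (\<lambda>Z. killing_deriv i j (\<lambda>W. ln (\<kappa> W Z)) X) Y"

definition stein_kernel ::
    "(real ^ 'r ^ 'n::{finite,linorder} \<Rightarrow> real) \<Rightarrow> (real ^ 'r ^ 'n::{finite,linorder} \<Rightarrow> real ^ 'r ^ 'n::{finite,linorder} \<Rightarrow> real) \<Rightarrow>
     real ^ 'r ^ 'n::{finite,linorder} \<Rightarrow> real ^ 'r ^ 'n::{finite,linorder} \<Rightarrow> real" where
  "stein_kernel p \<kappa> X Y = \<kappa> X Y *
    (\<Sum>(i, j) | i < j.
      killing_deriv i j (log_pk_fst p \<kappa> X Y) X * killing_deriv i j (log_pk_snd p \<kappa> X Y) Y +
      killing_mixed_log i j \<kappa> X Y)"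

end

theory Submission
  imports Defs
begin

text \<open>
  The matrices \<open>E\<^sub>i\<^sub>j = skew_basis i j\<close>, \<open>i < j\<close>, form an orthonormal basis of the skew-symmetric
  matrices. Differentiating \<open>f\<close> along the killing field gives
  \<open>\<nabla>f \<bullet> (E\<^sub>i\<^sub>j X) = E\<^sub>i\<^sub>j \<bullet> (\<nabla>f X\<^sup>T)\<close>, so Parseval's identity turns the sum of products of first derivatives
  into the inner product of the skew parts. For a radial kernel, skewness of \<open>E\<^sub>i\<^sub>j\<close> gives
  \<open>K\<^sub>X log \<kappa> = 2 \<psi>'(\<bar>X - Y\<bar>\<^sup>2) (Y \<bullet> E\<^sub>i\<^sub>j X)\<close>. Differentiating once more in \<open>Y\<close>, the \<open>\<psi>''\<close> terms are again summed
  by Parseval and the \<open>\<psi>'\<close> terms because the \<open>E\<^sub>i\<^sub>j\<^sup>T E\<^sub>i\<^sub>j\<close> add up to \<open>(N - 1)/2 I\<close>.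
\<close>

section \<open>Sums of symmetric functions over pairs\<close>

text \<open>Swapping coordinates identifies the sums over \<open>i < j\<close> and
  \<open>j < i\<close>; together with the diagonal these exhaust all pairs.\<close>

lemma sum_less_symmetric:
  fixes f :: "'n::{finite,linorder} \<Rightarrow> 'n \<Rightarrow> real"
  assumes "\<And>i j. f i j = f j i"
  shows "2 * (\<Sum>(i, j) | i < j. f i j) = (\<Sum>i\<in>UNIV. \<Sum>j\<in>UNIV. f i j) - (\<Sum>i\<in>UNIV. f i i)"
proof -
  let ?L = "{(i, j). i < (j::'n)}" and ?G = "{(i, j). j < (i::'n)}" and ?D = "range (\<lambda>i::'n. (i, i))"
  let ?F = "\<lambda>(i, j). f i j"
  have "sum ?F ?L = sum ?F ?G"
    by (rule sum.reindex_bij_witness[of _ prod.swap prod.swap]) (auto simp: assms split: prod.splits)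
  moreover have "sum ?F ?D = (\<Sum>i\<in>UNIV. f i i)"
    by (subst sum.reindex) (auto simp: inj_on_def)
  moreover have "(\<Sum>i\<in>UNIV. \<Sum>j\<in>UNIV. f i j) = sum ?F UNIV"
    by (simp add: sum.cartesian_product)
  moreover have "(UNIV :: ('n \<times> 'n) set) = (?L \<union> ?G) \<union> ?D"
    by (auto simp: image_iff)
  moreover have "sum ?F ((?L \<union> ?G) \<union> ?D) = sum ?F ?L + sum ?F ?G + sum ?F ?D"
    by (subst sum.union_disjoint, simp, simp, force)+ simp
  ultimately show ?thesis
    by simp
qed

section \<open>Matrix algebra and elementary matrices\<close>

lemma matrix_add_rdistrib: "(A + B) ** C = A ** C + B ** (C :: real ^ 'r ^ 'm)"
  by (simp add: matrix_matrix_mult_def vec_eq_iff distrib_right sum.distrib)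

lemma matrix_diff_rdistrib: "(A - B) ** C = A ** C - B ** (C :: real ^ 'r ^ 'm)"
  by (simp add: matrix_matrix_mult_def vec_eq_iff left_diff_distrib sum_subtractf)

lemma matrix_diff_ldistrib: "C ** (A - B) = C ** A - C ** (B :: real ^ 'r ^ 'm)"
  by (simp add: matrix_matrix_mult_def vec_eq_iff right_diff_distrib sum_subtractf)

lemma matrix_scaleR_left: "(k *\<^sub>R A) ** B = k *\<^sub>R (A ** (B :: real ^ 'r ^ 'm))"
  by (simp add: scalar_matrix_assoc)

lemma matrix_scaleR_right: "A ** (k *\<^sub>R B) = k *\<^sub>R (A ** (B :: real ^ 'r ^ 'm))"
  by (simp add: matrix_scalar_ac scalar_matrix_assoc)

lemma matrix_minus_left: "(- A) ** B = - (A ** (B :: real ^ 'r ^ 'm))"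
  using matrix_scaleR_left[of "-1" A B] by simp

lemma matrix_minus_right: "A ** (- B) = - (A ** (B :: real ^ 'r ^ 'm))"
  using matrix_scaleR_right[of A "-1" B] by simp

lemma transpose_add: "transpose (A + B) = transpose A + transpose (B :: real ^ 'm ^ 'n)"
  by (simp add: transpose_def vec_eq_iff)

lemma transpose_diff: "transpose (A - B) = transpose A - transpose (B :: real ^ 'm ^ 'n)"
  by (simp add: transpose_def vec_eq_iff)

lemma elementary_matrix_mult_nth:
  fixes X :: "real ^ 'r ^ 'n"
  shows "(elementary_matrix i j ** X) $ k = (if k = i then X $ j else 0)"
  by (simp add: elementary_matrix_def matrix_matrix_mult_def vec_eq_iff if_distrib[of "\<lambda>x. x * _"] cong: if_cong)

lemma elementary_matrix_mult:
  "elementary_matrix i j ** elementary_matrix k l = (if j = k then elementary_matrix i l else 0)"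
  by (auto simp: vec_eq_iff elementary_matrix_mult_nth) (auto simp: elementary_matrix_def)

lemma elementary_matrix_inner: "elementary_matrix i j \<bullet> A = A $ i $ j"
proof -
  have "elementary_matrix i j \<bullet> A = (\<Sum>k\<in>UNIV. \<Sum>l\<in>UNIV. if k = i \<and> l = j then A $ k $ l else 0)"
    by (auto simp: elementary_matrix_def inner_vec_def intro!: sum.cong)
  also have "\<dots> = (\<Sum>k\<in>UNIV. if k = i then A $ k $ j else 0)"
    by (rule sum.cong) (auto)
  finally show ?thesis by simp
qed

lemma transpose_elementary_matrix: "transpose (elementary_matrix i j) = elementary_matrix j i"
  by (simp add: elementary_matrix_def transpose_def vec_eq_iff conj_commute)

text \<open>Right multiplication by \<open>X\<close> has right multiplication by its transpose as
  adjoint. This separates \<open>X\<close> from a basis matrix \<open>A\<close>, so that Parseval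
  applies.\<close>

lemma matrix_mult_inner:
  fixes A :: "real ^ 'm ^ 'n" and X :: "real ^ 'r ^ 'm" and Y :: "real ^ 'r ^ 'n"
  shows "(A ** X) \<bullet> Y = A \<bullet> (Y ** transpose X)"
proof -
  have "(A ** X) \<bullet> Y = (\<Sum>i\<in>UNIV. \<Sum>l\<in>UNIV. \<Sum>k\<in>UNIV. A $ i $ k * X $ k $ l * Y $ i $ l)"
    by (simp add: inner_vec_def matrix_matrix_mult_def sum_distrib_right)
  also have "\<dots> = (\<Sum>i\<in>UNIV. \<Sum>k\<in>UNIV. \<Sum>l\<in>UNIV. A $ i $ k * X $ k $ l * Y $ i $ l)"
    by (intro sum.cong refl sum.swap)
  also have "\<dots> = A \<bullet> (Y ** transpose X)"
    by (simp add: inner_vec_def matrix_matrix_mult_def transpose_def sum_distrib_left mult_ac)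
  finally show ?thesis .
qed

section \<open>Parseval's identity for the skew basis\<close>

text \<open>The pairing is \<open>sqrt 2 / 2\<close> times \<open>A $ i $ j - A $ j $ i\<close>, and
  this difference is twice an entry of the skew part.\<close>

lemma skew_basis_inner: "skew_basis i j \<bullet> A = sqrt 2 * skew_part A $ i $ j"
  by (simp add: skew_basis_def skew_part_def inner_diff_left elementary_matrix_inner transpose_def)

text \<open>The factors \<open>sqrt 2\<close> multiply to 2, which turns the sum over
  \<open>i < j\<close> into one over all entries, as skew parts have zero diagonal.\<close>

lemma sum_skew_basis_inner:
  fixes A B :: "real ^ 'n::{finite,linorder} ^ 'n::{finite,linorder}"
  shows "(\<Sum>(i, j) | i < j. (skew_basis i j \<bullet> A) * (skew_basis i j \<bullet> B)) = skew_part A \<bullet> skew_part B"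
proof -
  let ?f = "\<lambda>i j. skew_part A $ i $ j * skew_part B $ i $ j"
  have "(\<Sum>(i, j) | i < j. (skew_basis i j \<bullet> A) * (skew_basis i j \<bullet> B)) = 2 * (\<Sum>(i, j) | i < j. ?f i j)"
    by (auto simp: skew_basis_inner sum_distrib_left intro!: sum.cong)
  also have "\<dots> = (\<Sum>i\<in>UNIV. \<Sum>j\<in>UNIV. ?f i j) - (\<Sum>i\<in>UNIV. ?f i i)"
    \<comment> \<open>Exchanging the indices flips the sign of both factors.\<close>
    by (rule sum_less_symmetric) (simp add: skew_part_def transpose_def algebra_simps)
  also have "\<dots> = skew_part A \<bullet> skew_part B"
    by (simp add: inner_vec_def skew_part_def transpose_def)
  finally show ?thesis .
qed

section \<open>Inner products of killing fields\<close>

lemma killing_field_inner: "killing_field i j X \<bullet> Y = skew_basis i j \<bullet> (Y ** transpose X)"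
  by (simp add: killing_field_def matrix_mult_inner)

text \<open>Skew-adjointness of \<open>skew_basis i j\<close>: exchanging \<open>X\<close> and
  \<open>Y\<close> transposes \<open>Y ** transpose X\<close>, which negates its skew part.\<close>

lemma killing_field_skew: "X \<bullet> killing_field i j Y = - (Y \<bullet> killing_field i j X)"
proof -
  have "skew_part (X ** transpose Y) = - skew_part (Y ** transpose X)"
    by (simp add: skew_part_def matrix_transpose_mul flip: scaleR_minus_right)
  then show ?thesis
    by (simp add: inner_commute[of _ "killing_field _ _ _"] killing_field_inner skew_basis_inner)
qed

lemma killing_field_inner_self: "X \<bullet> killing_field i j X = 0"
  using killing_field_skew[of X i j X] by simp

text \<open>For \<open>E = skew_basis i j\<close>, the matrix \<open>transpose E ** E\<close> is
  diagonal with 1/2 at positions \<open>i\<close> and \<open>j\<close>; each position lies in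
  \<open>N - 1\<close> pairs.\<close>

lemma sum_killing_field_inner:
  fixes X Y :: "real ^ 'r ^ 'n::{finite,linorder}"
  shows "(\<Sum>(i, j) | i < j. killing_field i j X \<bullet> killing_field i j Y) = (real CARD('n) - 1) / 2 * (X \<bullet> Y)"
proof -
  let ?f = "\<lambda>i j. if i = j then 0 else X $ i \<bullet> Y $ i + X $ j \<bullet> Y $ j"
  have *: "2 * (killing_field i j X \<bullet> killing_field i j Y) = ?f i j" if "i < j" for i j
  proof -
    have "2 * (killing_field i j X \<bullet> killing_field i j Y) =
        (\<Sum>k\<in>UNIV. (if k = i then X $ j \<bullet> Y $ j else 0) + (if k = j then X $ i \<bullet> Y $ i else 0))"
      using that
      by (auto simp: killing_field_def skew_basis_def inner_vec_def[of "_ :: real ^ 'r ^ 'n::{finite,linorder}"]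
          sum_distrib_left
          matrix_diff_rdistrib matrix_scaleR_left elementary_matrix_mult_nth intro!: sum.cong)
    also have "\<dots> = ?f i j"
      using that by (simp add: sum.distrib)
    finally show ?thesis .
  qed
  \<comment> \<open>One factor 2 clears the halves, the other symmetrises the sum.\<close>
  have "4 * (\<Sum>(i, j) | i < j. killing_field i j X \<bullet> killing_field i j Y) = 2 * (\<Sum>(i, j) | i < j. ?f i j)"
    using * by (auto simp: sum_distrib_left intro!: sum.cong)
  also have "\<dots> = (\<Sum>i\<in>UNIV. \<Sum>j\<in>UNIV. ?f i j)"
    by (subst sum_less_symmetric) auto
  \<comment> \<open>Restoring the diagonal gives \<open>2 * N\<close> copies of
    \<open>X \<bullet> Y\<close>, of which the correction removes 2.\<close>
  also have "\<dots> = (\<Sum>i\<in>UNIV. \<Sum>j\<in>UNIV. X $ i \<bullet> Y $ i + X $ j \<bullet> Y $ j - (if j = i then 2 * (X $ i \<bullet> Y $ i) else 0))"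
    by (intro sum.cong) auto
  also have "\<dots> = 4 * ((real CARD('n) - 1) / 2 * (X \<bullet> Y))"
    by (simp add: sum.distrib sum_subtractf inner_vec_def[of X Y] algebra_simps flip: sum_distrib_left)
  finally show ?thesis by linarith
qed

section \<open>Derivatives along curves and tangency of killing fields\<close>

text \<open>\<open>frechet_derivative\<close> picks some derivative within \<open>M\<close>, and
  these may differ in normal directions. Composition with a curve reduces the claim to uniqueness of
  derivatives on the real line.\<close>

lemma tangent_derivative_unique:
  assumes f: "(f has_derivative f') (at X within M)" and v: "v \<in> tangent_space M X"
  shows "frechet_derivative f (at X within M) v = f' v"
proof -
  obtain \<gamma> where \<gamma>: "\<gamma> 0 = X" "\<And>t. \<gamma> t \<in> M" "(\<gamma> has_vector_derivative v) (at (0::real))"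
    using v by (auto simp: tangent_space_def)
  have comp: "((\<lambda>t. f (\<gamma> t)) has_derivative (\<lambda>h. g (h *\<^sub>R v))) (at 0)"
    if "(f has_derivative g) (at X within M)" for g
  proof (rule has_derivative_in_compose[where f=\<gamma> and g=f and f'="\<lambda>h. h *\<^sub>R v" and g'=g])
    show "(\<gamma> has_derivative (\<lambda>h. h *\<^sub>R v)) (at 0)"
      using \<gamma>(3) by (simp add: has_vector_derivative_def)
    show "(f has_derivative g) (at (\<gamma> 0) within range \<gamma>)"
      unfolding \<gamma>(1) using that by (rule has_derivative_subset) (use \<gamma>(2) in blast)
  qed
  have "(f has_derivative frechet_derivative f (at X within M)) (at X within M)"
    using f by (meson differentiable_def frechet_derivative_works)
  from has_derivative_unique[OF comp[OF this] comp[OF f]] show ?thesis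
    by (metis scaleR_one)
qed

text \<open>Rodrigues' formula for \<open>exp (\<theta> J)\<close>, where \<open>s = sin \<theta>\<close> and \<open>c = cos \<theta>\<close>.\<close>

lemma orthogonal_matrix_rodrigues:
  fixes J :: "real ^ 'n ^ 'n"
  assumes skew: "transpose J = - J" and cube: "J ** J ** J = - J" and "s\<^sup>2 + c\<^sup>2 = 1"
  shows "orthogonal_matrix (mat 1 + s *\<^sub>R J + (1 - c) *\<^sub>R (J ** J))"
proof -
  define K where "K = J ** J"
  have K: "transpose K = K" "J ** J = K" "J ** K = - J" "K ** J = - J" "K ** K = - K"
    using cube
    by (simp_all add: K_def matrix_transpose_mul skew matrix_minus_left matrix_minus_right matrix_mul_assoc)
  have "transpose (mat 1 + s *\<^sub>R J + (1 - c) *\<^sub>R K) ** (mat 1 + s *\<^sub>R J + (1 - c) *\<^sub>R K)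
      = (mat 1 - s *\<^sub>R J + (1 - c) *\<^sub>R K) ** (mat 1 + s *\<^sub>R J + (1 - c) *\<^sub>R K)"
    by (simp add: transpose_add transpose_scalar skew K)
  \<comment> \<open>The terms in \<open>J\<close> cancel, and \<open>K\<close> collects the
    coefficient \<open>2 * (1 - c) - s\<^sup>2 - (1 - c)\<^sup>2\<close>.\<close>
  also have "\<dots> = mat 1 + (1 - (s\<^sup>2 + c\<^sup>2)) *\<^sub>R K"
    by (simp add: matrix_add_ldistrib matrix_add_rdistrib matrix_diff_rdistrib matrix_scaleR_left
        matrix_scaleR_right K) (simp add: algebra_simps power2_eq_square)
  finally show ?thesis
    by (simp add: orthogonal_matrix K assms flip: K_def)
qed

lemma stiefel_orthogonal_mult:
  assumes "orthogonal_matrix Q" "X \<in> stiefel"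
  shows "Q ** X \<in> stiefel"
proof -
  have "transpose (Q ** X) ** (Q ** X) = transpose X ** (transpose Q ** Q) ** X"
    by (simp add: matrix_transpose_mul matrix_mul_assoc)
  then show ?thesis
    using assms by (simp add: stiefel_def orthogonal_matrix)
qed

text \<open>The rotations \<open>exp (t E)\<close> with \<open>E = skew_basis i j\<close> move
  \<open>X\<close> along a curve in the manifold whose velocity at 0 is
  \<open>E ** X\<close>.\<close>

lemma killing_field_tangent:
  assumes X: "X \<in> stiefel" and "i \<noteq> j"
  shows "killing_field i j X \<in> tangent_space stiefel X"
proof -
  \<comment> \<open>\<open>J\<close> is left unnormalised so that \<open>J ** J ** J = - J\<close>;
    the scale \<open>a\<close> with \<open>skew_basis i j = a *\<^sub>R J\<close> enters through the
    angle \<open>a * t\<close>.\<close>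
  define J where "J = elementary_matrix i j - elementary_matrix j i"
  define a where "a = sqrt 2 / 2"
  define Q where "Q t = mat 1 + sin (a * t) *\<^sub>R J + (1 - cos (a * t)) *\<^sub>R (J ** J)" for t
  have "transpose J = - J"
    by (simp add: J_def transpose_diff transpose_elementary_matrix)
  \<comment> \<open>\<open>J ** J\<close> is minus the orthogonal projection onto the coordinates
    \<open>i\<close> and \<open>j\<close>.\<close>
  moreover have "J ** J ** J = - J"
    using \<open>i \<noteq> j\<close>
    by (simp add: J_def matrix_diff_ldistrib matrix_diff_rdistrib elementary_matrix_mult matrix_minus_left)
  ultimately have "orthogonal_matrix (Q t)" for t
    unfolding Q_def by (rule orthogonal_matrix_rodrigues) simp
  moreover have "((\<lambda>t. X + sin (a * t) *\<^sub>R (J ** X) + (1 - cos (a * t)) *\<^sub>R (J ** J ** X))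
      has_vector_derivative a *\<^sub>R (J ** X)) (at 0)"
    by (auto intro!: derivative_eq_intros)
  then have "((\<lambda>t. Q t ** X) has_vector_derivative killing_field i j X) (at 0)"
    by (simp add: Q_def matrix_add_rdistrib matrix_scaleR_left killing_field_def skew_basis_def J_def a_def)
  moreover have "Q 0 ** X = X"
    by (simp add: Q_def)
  ultimately show ?thesis
    unfolding tangent_space_def using X
    by (auto intro!: exI[of _ "\<lambda>t. Q t ** X"] stiefel_orthogonal_mult)
qed

section \<open>Killing derivatives and the gradient formula\<close>

lemma killing_deriv_eq:
  assumes "(f has_derivative f') (at X within stiefel)" "X \<in> stiefel" "i \<noteq> j"
  shows "killing_deriv i j f X = f' (killing_field i j X)"
  unfolding killing_deriv_def
  using assms by (intro tangent_derivative_unique killing_field_tangent)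

lemma killing_deriv_gradient:
  assumes "euclidean_gradient stiefel f X G" "X \<in> stiefel" "i \<noteq> j"
  shows "killing_deriv i j f X = skew_basis i j \<bullet> (G ** transpose X)"
  using assms killing_field_tangent[of X i j]
  by (simp add: killing_deriv_def euclidean_gradient_def inner_commute[of G] killing_field_inner)

text \<open>Each first derivative pairs a basis matrix with \<open>G ** transpose X\<close> or
  \<open>H ** transpose Y\<close>, so Parseval sums the products; the mixed terms are carried
  along.\<close>

lemma stein_kernel_gradient:
  fixes X Y :: "real ^ 'r ^ 'n::{finite,linorder}"
  assumes "X \<in> stiefel" "Y \<in> stiefel"
    and "euclidean_gradient stiefel (log_pk_fst p \<kappa> X Y) X G"
    and "euclidean_gradient stiefel (log_pk_snd p \<kappa> X Y) Y H"
  shows "stein_kernel p \<kappa> X Y =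
    (skew_part (G ** transpose X) \<bullet> skew_part (H ** transpose Y)) * \<kappa> X Y +
    (\<Sum>(i, j) | i < j. killing_mixed_log i j \<kappa> X Y) * \<kappa> X Y"
proof -
  have "(\<Sum>(i, j) | i < j.
        killing_deriv i j (log_pk_fst p \<kappa> X Y) X * killing_deriv i j (log_pk_snd p \<kappa> X Y) Y)
      = (\<Sum>(i, j) | i < j.
        (skew_basis i j \<bullet> (G ** transpose X)) * (skew_basis i j \<bullet> (H ** transpose Y)))"
    using assms by (auto intro!: sum.cong simp: killing_deriv_gradient)
  then show ?thesis
    by (simp add: stein_kernel_def case_prod_unfold sum.distrib
        sum_skew_basis_inner[unfolded case_prod_unfold] algebra_simps)
qed

section \<open>Radial kernels\<close>

text \<open>Chain rule; the one-sided derivative of \<open>\<psi>\<close> at 0 suffices because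
  squared norms are nonnegative.\<close>

lemma has_derivative_radial:
  assumes "(\<psi> has_real_derivative d) (at ((norm (X - Y))\<^sup>2) within {0..})"
  shows "((\<lambda>Z. \<psi> ((norm (Z - Y))\<^sup>2)) has_derivative (\<lambda>D. d * (2 * ((X - Y) \<bullet> D)))) (at X within M)"
proof -
  have "((\<lambda>Z. (norm (Z - Y))\<^sup>2) has_derivative (\<lambda>D. 2 * ((X - Y) \<bullet> D))) (at X within M)"
    unfolding power2_norm_eq_inner
    by (auto intro!: derivative_eq_intros simp: inner_commute)
  moreover have "(\<psi> has_derivative (*) d) (at ((norm (X - Y))\<^sup>2) within (\<lambda>Z. (norm (Z - Y))\<^sup>2) ` M)"
    using assms by (auto simp: has_field_derivative_def intro: has_derivative_subset)
  ultimately show ?thesis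
    by (rule has_derivative_in_compose)
qed

lemma killing_mixed_log_radial:
  fixes \<kappa> :: "real ^ 'r ^ 'n \<Rightarrow> real ^ 'r ^ 'n \<Rightarrow> real"
  assumes \<psi>: "C2_nonneg \<psi> \<psi>' \<psi>''"
    and \<kappa>: "\<And>X Y. X \<in> stiefel \<Longrightarrow> Y \<in> stiefel \<Longrightarrow> \<kappa> X Y = exp (- \<psi> ((norm (X - Y))\<^sup>2))"
    and X: "X \<in> stiefel" and Y: "Y \<in> stiefel" and ij: "i \<noteq> j"
  shows "killing_mixed_log i j \<kappa> X Y =
    2 * \<psi>' ((norm (X - Y))\<^sup>2) * (killing_field i j X \<bullet> killing_field i j Y) +
    4 * \<psi>'' ((norm (X - Y))\<^sup>2) * (skew_basis i j \<bullet> (X ** transpose Y))\<^sup>2"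
proof -
  let ?K = "killing_field i j"
  have d\<psi>: "(\<psi> has_real_derivative \<psi>' ((norm v)\<^sup>2)) (at ((norm v)\<^sup>2) within {0..})"
    "(\<psi>' has_real_derivative \<psi>'' ((norm v)\<^sup>2)) (at ((norm v)\<^sup>2) within {0..})" for v :: "real ^ 'r ^ 'n"
    using \<psi> by (simp_all add: C2_nonneg_def)
  \<comment> \<open>Computed for all \<open>Z\<close> on the manifold because it is differentiated
    in \<open>Z\<close> next. The \<open>X\<close> part of \<open>X - Z\<close> drops out, as
    \<open>X\<close> is orthogonal to its killing field.\<close>
  have inner_deriv: "killing_deriv i j (\<lambda>W. ln (\<kappa> W Z)) X = 2 * (\<psi>' ((norm (Z - X))\<^sup>2) * (Z \<bullet> ?K X))"
    if Z: "Z \<in> stiefel" for Z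
  proof -
    have "((\<lambda>W. ln (\<kappa> W Z)) has_derivative (\<lambda>D. - (\<psi>' ((norm (X - Z))\<^sup>2) * (2 * ((X - Z) \<bullet> D)))))
        (at X within stiefel)"
      by (rule has_derivative_transform[OF X _ has_derivative_minus[OF has_derivative_radial[OF d\<psi>(1)]]])
         (simp add: \<kappa> Z)
    from killing_deriv_eq[OF this X ij] show ?thesis
      by (simp add: inner_diff_left killing_field_inner_self norm_minus_commute)
  qed
  have "((\<lambda>Z. 2 * (\<psi>' ((norm (Z - X))\<^sup>2) * (Z \<bullet> ?K X))) has_derivative
      (\<lambda>D. 2 * (\<psi>' ((norm (Y - X))\<^sup>2) * (D \<bullet> ?K X) +
        \<psi>'' ((norm (Y - X))\<^sup>2) * (2 * ((Y - X) \<bullet> D)) * (Y \<bullet> ?K X)))) (at Y within stiefel)"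
    by (intro has_derivative_mult_right has_derivative_mult has_derivative_radial
        d\<psi> has_derivative_inner_left has_derivative_ident)
  \<comment> \<open>Agreement on \<open>stiefel\<close> is enough for derivatives within
    \<open>stiefel\<close>.\<close>
  then have "((\<lambda>Z. killing_deriv i j (\<lambda>W. ln (\<kappa> W Z)) X) has_derivative
      (\<lambda>D. 2 * (\<psi>' ((norm (Y - X))\<^sup>2) * (D \<bullet> ?K X) +
        \<psi>'' ((norm (Y - X))\<^sup>2) * (2 * ((Y - X) \<bullet> D)) * (Y \<bullet> ?K X)))) (at Y within stiefel)"
    by (rule has_derivative_transform[OF Y inner_deriv, rotated])
  from killing_deriv_eq[OF this Y ij]
  have "killing_mixed_log i j \<kappa> X Y = 2 * (\<psi>' ((norm (X - Y))\<^sup>2) * (?K X \<bullet> ?K Y)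
      - \<psi>'' ((norm (X - Y))\<^sup>2) * (2 * (X \<bullet> ?K Y)) * (Y \<bullet> ?K X))"
    by (simp add: killing_mixed_log_def inner_diff_left killing_field_inner_self
        norm_minus_commute[of Y] inner_commute[of "?K Y"])
  \<comment> \<open>This sign cancels the minus before \<open>\<psi>''\<close> and turns the product
    into a square.\<close>
  also have "Y \<bullet> ?K X = - (X \<bullet> ?K Y)"
    by (rule killing_field_skew)
  also have "X \<bullet> ?K Y = skew_basis i j \<bullet> (X ** transpose Y)"
    by (simp only: inner_commute[of X] killing_field_inner)
  finally show ?thesis
    by (simp add: algebra_simps power2_eq_square)
qed

text \<open>The factor 2 of the \<open>\<psi>'\<close> terms cancels the denominator of
  \<open>(N - 1) / 2\<close>; the squares add up to a squared norm by Parseval with equal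
  arguments.\<close>

lemma sum_killing_mixed_log_radial:
  fixes \<kappa> :: "real ^ 'r ^ 'n::{finite,linorder} \<Rightarrow> real ^ 'r ^ 'n::{finite,linorder} \<Rightarrow> real"
  assumes \<psi>: "C2_nonneg \<psi> \<psi>' \<psi>''"
    and \<kappa>: "\<And>X Y. X \<in> stiefel \<Longrightarrow> Y \<in> stiefel \<Longrightarrow> \<kappa> X Y = exp (- \<psi> ((norm (X - Y))\<^sup>2))"
    and X: "X \<in> stiefel" and Y: "Y \<in> stiefel"
  shows "(\<Sum>(i, j) | i < j. killing_mixed_log i j \<kappa> X Y) =
    (real CARD('n) - 1) * \<psi>' ((norm (X - Y))\<^sup>2) * (X \<bullet> Y) +
    4 * \<psi>'' ((norm (X - Y))\<^sup>2) * (norm (skew_part (X ** transpose Y)))\<^sup>2"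
proof -
  let ?a = "\<psi>' ((norm (X - Y))\<^sup>2)" and ?b = "\<psi>'' ((norm (X - Y))\<^sup>2)"
  have "(\<Sum>(i, j) | i < j. killing_mixed_log i j \<kappa> X Y) =
      (\<Sum>(i, j) | i < j. 2 * ?a * (killing_field i j X \<bullet> killing_field i j Y) +
        4 * ?b * (skew_basis i j \<bullet> (X ** transpose Y))\<^sup>2)"
    using killing_mixed_log_radial[OF \<psi> \<kappa> X Y] by (auto intro!: sum.cong)
  also have "\<dots> = 2 * ?a * (\<Sum>(i, j) | i < j. killing_field i j X \<bullet> killing_field i j Y) +
      4 * ?b * (\<Sum>(i, j) | i < j.
        (skew_basis i j \<bullet> (X ** transpose Y)) * (skew_basis i j \<bullet> (X ** transpose Y)))"
    by (simp add: case_prod_unfold sum.distrib sum_distrib_left power2_eq_square)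
  finally show ?thesis
    by (simp add: sum_killing_field_inner sum_skew_basis_inner power2_norm_eq_inner)
qed

theorem theorem5p2:
  fixes p :: "real ^ 'r ^ 'n::{finite,linorder} \<Rightarrow> real"
    and \<kappa> :: "real ^ 'r ^ 'n::{finite,linorder} \<Rightarrow> real ^ 'r ^ 'n::{finite,linorder} \<Rightarrow> real"
    and \<mu> :: "(real ^ 'r ^ 'n::{finite,linorder}) measure"
  assumes "CARD('r) \<le> CARD('n)"
    and "invariant_measure \<mu>"
    and "positive_density \<mu> p"
    and "locally_lipschitz_on stiefel p"
    and "kernel_on stiefel \<kappa>"
    and "\<forall>X\<in>stiefel. \<forall>Y\<in>stiefel. \<kappa> X Y > 0"
    and "C11_on stiefel \<kappa>"
  shows
    "(\<forall>X\<in>stiefel. \<forall>Y\<in>stiefel. \<forall>G H.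
        euclidean_gradient stiefel (log_pk_fst p \<kappa> X Y) X G \<longrightarrow>
        euclidean_gradient stiefel (log_pk_snd p \<kappa> X Y) Y H \<longrightarrow>
        stein_kernel p \<kappa> X Y =
          (skew_part (G ** transpose X) \<bullet> skew_part (H ** transpose Y)) * \<kappa> X Y +
          (\<Sum>(i, j) | i < j. killing_mixed_log i j \<kappa> X Y) * \<kappa> X Y)
     \<and>
     (\<forall>\<psi> \<psi>' \<psi>''. C2_nonneg \<psi> \<psi>' \<psi>'' \<longrightarrow>
        (\<forall>X\<in>stiefel. \<forall>Y\<in>stiefel. \<kappa> X Y = exp (- \<psi> ((norm (X - Y))\<^sup>2))) \<longrightarrow>
        (\<forall>X\<in>stiefel. \<forall>Y\<in>stiefel. \<forall>G H.
          euclidean_gradient stiefel (log_pk_fst p \<kappa> X Y) X G \<longrightarrow>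
          euclidean_gradient stiefel (log_pk_snd p \<kappa> X Y) Y H \<longrightarrow>
          stein_kernel p \<kappa> X Y =
            (skew_part (G ** transpose X) \<bullet> skew_part (H ** transpose Y)) * \<kappa> X Y +
            (real CARD('n) - 1) * \<psi>' ((norm (X - Y))\<^sup>2) * (X \<bullet> Y) * \<kappa> X Y +
            4 * \<psi>'' ((norm (X - Y))\<^sup>2) * (norm (skew_part (X ** transpose Y)))\<^sup>2 * \<kappa> X Y))"
proof (intro conjI allI ballI impI, goal_cases)
  case (1 X Y G H)
  then show ?case
    by (rule stein_kernel_gradient)
next
  case (2 \<psi> \<psi>' \<psi>'' X Y G H)
  have "\<And>X Y. X \<in> stiefel \<Longrightarrow> Y \<in> stiefel \<Longrightarrow> \<kappa> X Y = exp (- \<psi> ((norm (X - Y))\<^sup>2))"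
    using 2(2) by blast
  from sum_killing_mixed_log_radial[OF 2(1) this 2(3,4)] show ?case
    by (simp add: stein_kernel_gradient[OF 2(3-6)] distrib_right)
qed

end
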